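(* The codes $B_k$ (for every integer $k\ge 1$) and $D_q$ (for every prime power $q$) are strictly compact MWS codes. In particular, $$S(B_k)=\{1,2,\ldots,2^k-2,2^k-1\}$$ (where $2^k-1$ is the length of $B_k$), and $$S(D_q)=\left\{\frac{q(q-1)}{2},\;\ldots,\;\frac{q(q+1)}{2}\right\}$$ (all integers from $\frac{q(q-1)}{2}$, the minimum distance of $D_q$, to $\frac{q(q+1)}{2}$, the length of $D_q$).
   Context: For a linear code $C$, $S(C)$ denotes the set of Hamming weights of nonzero codewords of $C$. With $q_k=\frac{q^k-1}{q-1}$, a $k$-dimensional linear code over $\mathbb{F}_q$ has at most $q_k$ distinct nonzero weights; it is called a maximum weight spectrum (MWS) code if $|S(C)|=q_k$. An MWS code $C$ of length $n$, dimension $k$ and minimum distance $d$ is compact if $S(C)=\{d,d+1,\ldots,d+q_k-1\}$, and strictly compact if it is compact and $n\in S(C)$. $B_k$ is the binary linear code of length $2^k-1$ and dimension $k$ generated by the rows $1_1^{(k)},\ldots,1_k^{(k)}$, where $1_i^{(k)}\in\mathbb{F}_2^{2^k-1}$ is the vector whose first $2^i-1$ entries equal $1$ and whose remaining entries equal $0$. $D_q$ is the linear code over $\mathbb{F}_q$ of length $\frac{q(q+1)}{2}$ and dimension $2$ generated by the rows of the $2\times\frac{q(q+1)}{2}$ matrix whose columns are: $\begin{pmatrix}1\\ \alpha^i\end{pmatrix}$ repeated $i$ times for each $i=1,\ldots,q-1$, and $\begin{pmatrix}1\\0\end{pmatrix}$ repeated $q$ times, where $\alpha$ is a primitive element of $\mathbb{F}_q$.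 *)

theory Defs
  imports "Jordan_Normal_Form.VS_Connect" "HOL-Algebra.Multiplicative_Group" "HOL-Library.Z2" "HOL-Library.Cardinality"
begin

instance bit :: finite
proof
  have "(UNIV :: bit set) \<subseteq> {0, 1}"
    by (metis (full_types) bit_not_zero_iff insertCI subsetI)
  then show "finite (UNIV :: bit set)"
    by (rule finite_subset) simp
qed

definition linear_code :: "nat \<Rightarrow> 'a::field vec set \<Rightarrow> bool" where
  "linear_code n C \<longleftrightarrow> VectorSpace.subspace class_ring C (module_vec TYPE('a) n)"

definition code_dim :: "nat \<Rightarrow> 'a::field vec set \<Rightarrow> nat" where
  "code_dim n C = vectorspace.dim class_ring ((module_vec TYPE('a) n)\<lparr>carrier := C\<rparr>)"

definition code_of :: "'a::field mat \<Rightarrow> 'a vec set" where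
  "code_of G = LinearCombinations.module.span class_ring
     (module_vec TYPE('a) (dim_col G)) (set (rows G))"

definition hamming_dist :: "'a vec \<Rightarrow> 'a vec \<Rightarrow> nat" where
  "hamming_dist u v = card {i. i < dim_vec u \<and> u $ i \<noteq> v $ i}"

definition hamming_weight :: "'a::zero vec \<Rightarrow> nat" where
  "hamming_weight v = card {i. i < dim_vec v \<and> v $ i \<noteq> 0}"

definition weights :: "'a::zero vec set \<Rightarrow> nat set" where
  "weights C = {hamming_weight c | c. c \<in> C \<and> c \<noteq> 0\<^sub>v (dim_vec c)}"

text \<open>Unspecified for the zero code, which has no two distinct codewords.\<close>

definition min_dist :: "'a vec set \<Rightarrow> nat" where
  "min_dist C = Min {hamming_dist u v | u v. u \<in> C \<and> v \<in> C \<and> u \<noteq> v}"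

text \<open>The division is exact: this is $1 + q + \dots + q^{k-1}$.\<close>

definition num_points :: "nat \<Rightarrow> nat \<Rightarrow> nat" where
  "num_points q k = (q ^ k - 1) div (q - 1)"

definition mws_code :: "nat \<Rightarrow> 'a::{field,finite} vec set \<Rightarrow> bool" where
  "mws_code n C \<longleftrightarrow>
     linear_code n C \<and> card (weights C) = num_points CARD('a) (code_dim n C)"

text \<open>The half-open interval is the set $\{d, d+1, \dots, d+q_k-1\}$.\<close>

definition compact_mws_code :: "nat \<Rightarrow> 'a::{field,finite} vec set \<Rightarrow> bool" where
  "compact_mws_code n C \<longleftrightarrow> mws_code n C \<and>
     weights C = {min_dist C ..< min_dist C + num_points CARD('a) (code_dim n C)}"

definition strictly_compact_mws_code :: "nat \<Rightarrow> 'a::{field,finite} vec set \<Rightarrow> bool" where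
  "strictly_compact_mws_code n C \<longleftrightarrow> compact_mws_code n C \<and> n \<in> weights C"

definition B_row :: "nat \<Rightarrow> nat \<Rightarrow> bit vec" where
  "B_row k i = vec (2 ^ k - 1) (\<lambda>j. if j < 2 ^ i - 1 then 1 else 0)"

definition B_code :: "nat \<Rightarrow> bit vec set" where
  "B_code k = code_of (mat_of_rows (2 ^ k - 1) (map (B_row k) [1..<k + 1]))"

definition primitive_element :: "'a::field \<Rightarrow> bool" where
  "primitive_element \<alpha> \<longleftrightarrow> {\<alpha> ^ i | i :: nat. True} = UNIV - {0}"

definition D_mat :: "'a::{field,finite} \<Rightarrow> 'a mat" where
  "D_mat \<alpha> = mat_of_cols 2
     (concat (map (\<lambda>i. replicate i (vec_of_list [1, \<alpha> ^ i])) [1..<CARD('a)])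
      @ replicate CARD('a) (vec_of_list [1, 0]))"

lemma D_mat_carrier: "D_mat (\<alpha>::'a::{field,finite}) \<in> carrier_mat 2 (CARD('a) * (CARD('a) + 1) div 2)"
proof -
  have *: "sum_list [1..<q] + q = q * (q + 1) div 2" for q :: nat
    by (induction q) auto
  have "dim_col (D_mat \<alpha>) = CARD('a) * (CARD('a) + 1) div 2"
    unfolding *[symmetric] by (simp add: D_mat_def length_concat o_def del: upt_Suc)
  moreover have "dim_row (D_mat \<alpha>) = 2"
    by (simp add: D_mat_def)
  ultimately show ?thesis by blast
qed

lemma ex_primitive_element: "\<exists>\<alpha>::'a::{field,finite}. primitive_element \<alpha>"
proof -
  have "finite (carrier (class_ring :: 'a ring))"
    by simp
  from field.finite_field_mult_group_has_gen[OF class_field this]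
  obtain a :: 'a where "UNIV - {0} = {a ^ i | i :: nat. True}"
    by (auto simp: carrier_mult_of class_ring_simps)
  then show ?thesis
    unfolding primitive_element_def by metis
qed

definition D_code :: "'a::{field,finite} \<Rightarrow> 'a vec set" where
  "D_code \<alpha> = code_of (D_mat \<alpha>)"

end

theory Submission
  imports Defs "Jordan_Normal_Form.DL_Rank"
begin

text \<open>
  Both codes are given by a generator matrix \<open>G\<close>, so every codeword is an encoding \<open>G\<^sup>T x\<close> of a
  message \<open>x\<close>. If the encodings of the nonzero messages have exactly the weights
  \<open>d, \<dots>, n\<close> with \<open>1 \<le> d\<close>, then no nonzero message is encoded by the zero word; hence the rows are
  independent, the dimension is the number of rows, and by linearity the minimum distance is \<open>d\<close>.
  A strictly compact MWS code is thus a matter of computing the weights of the encodings and of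
  checking that \<open>n + 1 - d\<close> is the number of points \<open>(q\<^sup>k - 1) / (q - 1)\<close> (\<open>strictly_compact_code_of\<close>).

  For \<open>B\<^sub>k\<close>, cut the \<open>2\<^sup>k - 1\<close> positions into consecutive blocks of sizes
  \<open>1, 2, 4, \<dots>, 2 ^ (k - 1)\<close>. The encoding of \<open>x\<close> is constant on each block, its value on a block being a sum of
  a final segment of \<open>x\<close>. So the weight is a number written in binary whose digits are these
  sums (\<open>hamming_weight_B_encoding\<close>). Passing from \<open>x\<close> to its sums over final segments is invertible, so
  all nonzero digit sequences occur, and the weights are \<open>1, \<dots>, 2\<^sup>k - 1\<close>.

  For \<open>D\<^sub>q\<close>, the message \<open>(a, b)\<close> is encoded as the values of \<open>a + b t\<close>, each \<open>t\<close> in the field being used with its own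
  multiplicity: \<open>i\<close> times for \<open>t = \<alpha>\<^sup>i\<close> with \<open>1 \<le> i < q\<close>, and \<open>q\<close> times for \<open>t = 0\<close>. A nonzero
  polynomial of degree at most one has at most one root, so the number of zeros in the codeword is \<open>0\<close> or one of the
  multiplicities \<open>1, \<dots>, q\<close>, and any root, or none, can be prescribed (\<open>D_spectrum\<close>). The
  weights therefore run from \<open>n - q\<close> to \<open>n\<close>.
\<close>

section \<open>Linear codes given by a generator matrix\<close>

lemma code_of_eq_image:
  fixes G :: "'a::field mat"
  assumes G: "G \<in> carrier_mat k n"
  shows "code_of G = (\<lambda>x. G\<^sup>T *\<^sub>v x) ` carrier_vec k"
proof -
  interpret vec_space "TYPE('a)" n .
  have "code_of G = row_space G"
    using G by (simp add: code_of_def row_space_def)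
  also have "\<dots> = (\<lambda>x. G\<^sup>T *\<^sub>v x) ` carrier_vec k"
    using G unfolding row_space_eq[OF G] by auto
  finally show ?thesis .
qed

lemma linear_code_code_of:
  fixes G :: "'a::field mat"
  assumes G: "G \<in> carrier_mat k n"
  shows "linear_code n (code_of G)"
proof -
  interpret vec_space "TYPE('a)" n .
  have "set (rows G) \<subseteq> carrier_vec n"
    using G rows_carrier[of G] by auto
  then have "VectorSpace.subspace class_ring (span (set (rows G))) V"
    by (simp add: span_is_subspace)
  then show ?thesis
    using G by (simp add: linear_code_def code_of_def)
qed

lemma mult_mat_vec_unit:
  fixes A :: "'a::comm_ring_1 mat"
  assumes "A \<in> carrier_mat n k" "i < k"
  shows "A *\<^sub>v unit_vec k i = col A i"
  using assms by (intro eq_vecI) auto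

text \<open>
  An injective encoding makes the rows of \<open>G\<close> linearly independent. They also have to be pairwise
  distinct for their number to be the dimension of the span of the \<^emph>\<open>set\<close> of rows; if two rows
  were equal, the difference of the corresponding unit messages would be encoded by zero.
\<close>

lemma code_dim_code_of:
  fixes G :: "'a::field mat"
  assumes G: "G \<in> carrier_mat k n"
    and inj: "\<And>x. x \<in> carrier_vec k \<Longrightarrow> G\<^sup>T *\<^sub>v x = 0\<^sub>v n \<Longrightarrow> x = 0\<^sub>v k"
  shows "code_dim n (code_of G) = k"
proof -
  interpret vec_space "TYPE('a)" n .
  have T: "G\<^sup>T \<in> carrier_mat n k"
    using G by simp
  have "i = j" if ij: "i < k" "j < k" and eq: "col G\<^sup>T i = col G\<^sup>T j" for i j
  proof -
    let ?e = "unit_vec k i - unit_vec k j :: 'a vec"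
    have "G\<^sup>T *\<^sub>v ?e = col G\<^sup>T i - col G\<^sup>T j"
      using T ij by (simp add: mult_minus_distrib_mat_vec[OF T] mult_mat_vec_unit[OF T])
    also have "\<dots> = 0\<^sub>v n"
      using T ij by (auto simp: eq)
    finally have "?e = 0\<^sub>v k"
      by (intro inj) auto
    then have "?e $ i = 0"
      using ij by simp
    then show ?thesis
      using ij by (auto split: if_splits)
  qed
  then have dist: "distinct (cols G\<^sup>T)"
    using T by (auto simp: distinct_conv_nth)
  have "lin_indpt (set (cols G\<^sup>T))"
    using lin_depE[OF T _ dist] inj by metis
  then have "rank G\<^sup>T = k"
    by (rule lin_indpt_full_rank[OF T dist])
  then show ?thesis
    using G by (simp add: rank_def code_dim_def code_of_def)
qed

lemma hamming_dist_eq_weight_diff: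
  fixes u v :: "'a::group_add vec"
  assumes "u \<in> carrier_vec n" "v \<in> carrier_vec n"
  shows "hamming_dist u v = hamming_weight (u - v)"
  using assms unfolding hamming_dist_def hamming_weight_def
  by (intro arg_cong[where f = card]) auto

text \<open>
  The distance of two words is the weight of their difference, which by linearity is again a
  codeword; conversely, a weight is the distance to the zero word.
\<close>

lemma min_dist_code_of:
  fixes G :: "'a::field mat"
  assumes G: "G \<in> carrier_mat k n"
  shows "min_dist (code_of G) = Min (weights (code_of G))"
proof -
  let ?C = "code_of G"
  have C: "?C = (\<lambda>x. G\<^sup>T *\<^sub>v x) ` carrier_vec k"
    by (rule code_of_eq_image[OF G])
  have T: "G\<^sup>T \<in> carrier_mat n k"
    using G by simp
  have carrier: "c \<in> carrier_vec n" if "c \<in> ?C" for c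
    using that T unfolding C by auto
  have diff: "u - v \<in> ?C" if uv: "u \<in> ?C" "v \<in> ?C" for u v
  proof -
    obtain x y where "x \<in> carrier_vec k" "u = G\<^sup>T *\<^sub>v x" "y \<in> carrier_vec k" "v = G\<^sup>T *\<^sub>v y"
      using uv unfolding C by auto
    then have "u - v = G\<^sup>T *\<^sub>v (x - y)" "x - y \<in> carrier_vec k"
      by (auto simp: mult_minus_distrib_mat_vec[OF T])
    then show ?thesis
      unfolding C by blast
  qed
  have zero: "0\<^sub>v n \<in> ?C"
    unfolding C using T by (intro image_eqI[of _ _ "0\<^sub>v k"]) auto
  have "{hamming_dist u v | u v. u \<in> ?C \<and> v \<in> ?C \<and> u \<noteq> v} = weights ?C" (is "?L = _")
  proof (intro equalityI subsetI)
    fix w assume "w \<in> ?L"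
    then obtain u v where uv: "u \<in> ?C" "v \<in> ?C" "u \<noteq> v" and w: "w = hamming_dist u v"
      by auto
    have "u - v \<noteq> 0\<^sub>v n"
    proof
      assume z: "u - v = 0\<^sub>v n"
      have "u = v"
      proof (rule eq_vecI)
        fix i assume i: "i < dim_vec v"
        have "(u - v) $ i = 0"
          using i carrier[OF uv(2)] unfolding z by simp
        then show "u $ i = v $ i"
          using i by simp
      qed (use carrier[OF uv(1)] carrier[OF uv(2)] in simp)
      with uv(3) show False ..
    qed
    moreover have "w = hamming_weight (u - v)"
      using hamming_dist_eq_weight_diff[OF carrier[OF uv(1)] carrier[OF uv(2)]] by (simp add: w)
    ultimately show "w \<in> weights ?C"
      using diff[OF uv(1,2)] carrier[OF uv(2)] unfolding weights_def by auto
  next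
    fix w assume "w \<in> weights ?C"
    then obtain c where c: "c \<in> ?C" "c \<noteq> 0\<^sub>v n" and w: "w = hamming_weight c"
      using carrier unfolding weights_def by fastforce
    then have "w = hamming_dist c (0\<^sub>v n)"
      using carrier[of c] by (auto simp: hamming_dist_def hamming_weight_def intro!: arg_cong[where f = card])
    then show "w \<in> ?L"
      using c zero by blast
  qed
  then show ?thesis
    by (simp add: min_dist_def)
qed

text \<open>
  Since the spectrum of the nonzero messages avoids \<open>0\<close>, the encoding is injective, so these
  messages correspond exactly to the nonzero codewords.
\<close>

lemma strictly_compact_code_of:
  fixes G :: "'a::{field,finite} mat"
  assumes G: "G \<in> carrier_mat k n"
    and d: "1 \<le> d" "d \<le> n"
    and count: "n + 1 - d = num_points CARD('a) k"
    and spectrum: "(\<lambda>x. hamming_weight (G\<^sup>T *\<^sub>v x)) ` (carrier_vec k - {0\<^sub>v k}) = {d..n}"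
  shows "code_dim n (code_of G) = k" "strictly_compact_mws_code n (code_of G)"
    "min_dist (code_of G) = d" "weights (code_of G) = {d..n}"
proof -
  have T: "G\<^sup>T \<in> carrier_mat n k"
    using G by simp
  have inj: "x = 0\<^sub>v k" if x: "x \<in> carrier_vec k" and z: "G\<^sup>T *\<^sub>v x = 0\<^sub>v n" for x
  proof (rule ccontr)
    assume "x \<noteq> 0\<^sub>v k"
    then have "hamming_weight (G\<^sup>T *\<^sub>v x) \<in> {d..n}"
      using x unfolding spectrum[symmetric] by blast
    moreover have "hamming_weight (0\<^sub>v n :: 'a vec) = 0"
      by (auto simp: hamming_weight_def)
    ultimately show False
      using d by (simp add: z)
  qed
  show dim: "code_dim n (code_of G) = k"
    by (rule code_dim_code_of[OF G inj])
  have "G\<^sup>T *\<^sub>v x = 0\<^sub>v n \<longleftrightarrow> x = 0\<^sub>v k" if "x \<in> carrier_vec k" for x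
    using inj[OF that] T by auto
  then have "weights (code_of G) =
      (\<lambda>x. hamming_weight (G\<^sup>T *\<^sub>v x)) ` (carrier_vec k - {0\<^sub>v k})"
    unfolding weights_def code_of_eq_image[OF G] using G by auto
  then show wt: "weights (code_of G) = {d..n}"
    by (simp only: spectrum)
  then show md: "min_dist (code_of G) = d"
    using d unfolding min_dist_code_of[OF G] by (simp only:) (rule Min_eqI, simp_all)
  have "{d..n} = {d..<d + num_points CARD('a) k}"
    using d unfolding count[symmetric] by (simp add: atLeastLessThanSuc_atLeastAtMost)
  moreover have "card {d..n} = num_points CARD('a) k" "n \<in> {d..n}"
    using d unfolding count[symmetric] by simp_all
  ultimately show "strictly_compact_mws_code n (code_of G)"
    unfolding strictly_compact_mws_code_def compact_mws_code_def mws_code_def dim wt md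
    using linear_code_code_of[OF G] by blast
qed

section \<open>The binary codes \<open>B\<^sub>k\<close>\<close>

lemma sum_dyadic_blocks:
  fixes f :: "nat \<Rightarrow> 'a::comm_monoid_add"
  shows "(\<Sum>j\<in>{0..<2 ^ k - 1}. f j) = (\<Sum>i\<in>{0..<k}. \<Sum>j\<in>{2 ^ i - 1..<2 ^ Suc i - 1}. f j)"
proof (induction k)
  case (Suc k)
  have le: "(2::nat) ^ k - 1 \<le> 2 ^ Suc k - 1"
    by (intro diff_le_mono power_increasing) auto
  have "(\<Sum>j\<in>{0..<2 ^ Suc k - 1}. f j)
      = (\<Sum>j\<in>{0..<2 ^ k - 1}. f j) + (\<Sum>j\<in>{2 ^ k - 1..<2 ^ Suc k - 1}. f j)"
    using le by (intro sum.atLeastLessThan_concat[symmetric]) simp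
  then show ?case
    by (simp only: Suc.IH sum.atLeast0_lessThan_Suc)
qed simp

definition B_mat :: "nat \<Rightarrow> bit mat" where
  "B_mat k = mat_of_rows (2 ^ k - 1) (map (B_row k) [1..<k + 1])"

lemma B_mat_carrier: "B_mat k \<in> carrier_mat k (2 ^ k - 1)"
  unfolding B_mat_def by (intro carrier_matI) simp_all

definition suffix_sum :: "'a::comm_monoid_add vec \<Rightarrow> nat \<Rightarrow> 'a" where
  "suffix_sum x i = (\<Sum>l\<in>{i..<dim_vec x}. x $ l)"

lemma suffix_sum_eq_0_imp_zero:
  fixes x :: "'a::comm_monoid_add vec"
  assumes x: "x \<in> carrier_vec k" and z: "\<And>i. i < k \<Longrightarrow> suffix_sum x i = 0"
  shows "x = 0\<^sub>v k"
proof (rule eq_vecI)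
  fix i assume "i < dim_vec (0\<^sub>v k :: 'a vec)"
  then have i: "i < k"
    by simp
  have "suffix_sum x (Suc i) = 0"
    using z[of "Suc i"] x by (cases "Suc i < k") (auto simp: suffix_sum_def)
  moreover have "suffix_sum x i = x $ i + suffix_sum x (Suc i)"
    using i x by (simp add: suffix_sum_def sum.atLeast_Suc_lessThan)
  ultimately show "x $ i = 0\<^sub>v k $ i"
    using z[OF i] i by simp
qed (use x in simp)

text \<open>Taking successive differences inverts the formation of suffix sums.\<close>

lemma ex_suffix_sum:
  fixes y :: "nat \<Rightarrow> 'a::ab_group_add"
  shows "\<exists>x\<in>carrier_vec k. \<forall>i<k. suffix_sum x i = y i"
proof (intro bexI allI impI)
  define z where "z i = (if i < k then y i else 0)" for i
  let ?x = "vec k (\<lambda>i. z i - z (Suc i))"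
  show "?x \<in> carrier_vec k"
    by simp
  fix i assume i: "i < k"
  have "suffix_sum ?x i = (\<Sum>l\<in>{i..<k}. z l - z (Suc l))"
    by (simp add: suffix_sum_def)
  also have "\<dots> = - (\<Sum>l\<in>{i..<k}. z (Suc l) - z l)"
    by (simp flip: sum_negf)
  also have "\<dots> = z i - z k"
    using i by (subst sum_Suc_diff') simp_all
  finally show "suffix_sum ?x i = y i"
    using i by (simp add: z_def)
qed

text \<open>
  Counting rows from \<open>0\<close>, row \<open>l\<close> is \<open>1\<close> exactly on the first \<open>2 ^ Suc l - 1\<close> positions, that is on
  the blocks \<open>0, \<dots>, l\<close>. So block \<open>i\<close> meets the rows \<open>i, \<dots>, k - 1\<close>.
\<close>

lemma B_coordinate:
  assumes x: "x \<in> carrier_vec k" and i: "i < k" and j: "j \<in> {2 ^ i - 1..<2 ^ Suc i - 1}"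
  shows "((B_mat k)\<^sup>T *\<^sub>v x) $ j = suffix_sum x i"
proof -
  have le: "(2::nat) ^ Suc i \<le> 2 ^ k"
    using i by (intro power_increasing) auto
  have jn: "j < 2 ^ k - 1"
    using j less_le_trans[OF _ diff_le_mono[OF le]] by simp
  have block: "j < 2 ^ Suc l - 1 \<longleftrightarrow> i \<le> l" for l
  proof
    assume "i \<le> l"
    then have "(2::nat) ^ Suc i \<le> 2 ^ Suc l"
      by (intro power_increasing) auto
    then show "j < 2 ^ Suc l - 1"
      using j less_le_trans[OF _ diff_le_mono] by auto
  next
    assume jl: "j < 2 ^ Suc l - 1"
    show "i \<le> l"
    proof (rule ccontr)
      assume "\<not> i \<le> l"
      then have "(2::nat) ^ Suc l \<le> 2 ^ i"
        by (intro power_increasing) auto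
      then have "(2::nat) ^ Suc l - 1 \<le> 2 ^ i - 1"
        by (rule diff_le_mono)
      then show False
        using j jl by (simp del: power_Suc)
    qed
  qed
  have "((B_mat k)\<^sup>T *\<^sub>v x) $ j = (\<Sum>l\<in>{0..<k}. B_mat k $$ (l, j) * x $ l)"
    using B_mat_carrier[of k] x jn by (simp add: scalar_prod_def)
  also have "\<dots> = (\<Sum>l\<in>{0..<k}. if l \<in> {i..<k} then x $ l else 0)"
    using jn block by (intro sum.cong) (simp_all add: B_mat_def mat_of_rows_index B_row_def del: upt_Suc power_Suc)
  also have "\<dots> = suffix_sum x i"
    using x unfolding suffix_sum_def
    by (subst sum.inter_restrict[symmetric]) (auto intro!: sum.cong)
  finally show ?thesis .
qed

text \<open>Block \<open>i\<close> has \<open>2 ^ i\<close> positions, and the codeword is either zero or nonzero on all of them.\<close>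

lemma hamming_weight_B_encoding:
  assumes x: "x \<in> carrier_vec k"
  shows "hamming_weight ((B_mat k)\<^sup>T *\<^sub>v x) = (\<Sum>i\<in>{0..<k}. if suffix_sum x i \<noteq> 0 then 2 ^ i else 0)"
proof -
  let ?c = "(B_mat k)\<^sup>T *\<^sub>v x"
  have "hamming_weight ?c = card ({0..<2 ^ k - 1} \<inter> {j. ?c $ j \<noteq> 0})"
    using B_mat_carrier[of k] unfolding hamming_weight_def
    by (intro arg_cong[where f = card]) auto
  also have "\<dots> = (\<Sum>j\<in>{0..<2 ^ k - 1}. of_bool (?c $ j \<noteq> 0))"
    by (subst sum_of_bool_eq) simp_all
  also have "\<dots> = (\<Sum>i\<in>{0..<k}. \<Sum>j\<in>{2 ^ i - 1..<2 ^ Suc i - 1}. of_bool (?c $ j \<noteq> 0))"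
    by (rule sum_dyadic_blocks)
  also have "\<dots> = (\<Sum>i\<in>{0..<k}. \<Sum>j\<in>{2 ^ i - 1..<2 ^ Suc i - (1::nat)}. of_bool (suffix_sum x i \<noteq> 0))"
    using B_coordinate[OF x] by (intro sum.cong refl) (simp del: power_Suc)
  also have "\<dots> = (\<Sum>i\<in>{0..<k}. if suffix_sum x i \<noteq> 0 then 2 ^ i else 0)"
    by (intro sum.cong refl) simp
  finally show ?thesis .
qed

lemma B_spectrum:
  "(\<lambda>x. hamming_weight ((B_mat k)\<^sup>T *\<^sub>v x)) ` (carrier_vec k - {0\<^sub>v k}) = {1..2 ^ k - 1}"
proof (intro equalityI subsetI)
  fix w assume "w \<in> (\<lambda>x. hamming_weight ((B_mat k)\<^sup>T *\<^sub>v x)) ` (carrier_vec k - {0\<^sub>v k})"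
  then obtain x where x: "x \<in> carrier_vec k" "x \<noteq> 0\<^sub>v k"
    and w: "w = hamming_weight ((B_mat k)\<^sup>T *\<^sub>v x)"
    by auto
  obtain i where i: "i < k" "suffix_sum x i \<noteq> 0"
    using suffix_sum_eq_0_imp_zero[OF x(1)] x(2) by blast
  then have "0 < w"
    unfolding w hamming_weight_B_encoding[OF x(1)] by (intro sum_pos2[of _ i]) auto
  moreover have "w \<le> card {..<2 ^ k - (1::nat)}"
    using B_mat_carrier[of k] unfolding w hamming_weight_def by (intro card_mono) auto
  ultimately show "w \<in> {1..2 ^ k - 1}"
    by simp
next
  fix w :: nat assume w: "w \<in> {1..2 ^ k - 1}"
  \<comment> \<open>The message is chosen so that its suffix sums are the binary digits of \<open>w\<close>.\<close>
  obtain x :: "bit vec" where x: "x \<in> carrier_vec k"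
    and bits: "\<forall>i<k. suffix_sum x i = of_bool (bit w i)"
    by (rule bexE[OF ex_suffix_sum[of k "\<lambda>i. of_bool (bit w i)"]])
  have "w \<le> 2 ^ k - 1" "(0::nat) < 2 ^ k"
    using w by simp_all
  then have "w < 2 ^ k"
    by linarith
  then have "w = (\<Sum>i = 0..<k. push_bit i (of_bool (bit w i)))"
    by (simp add: take_bit_nat_eq_self flip: take_bit_sum)
  also have "\<dots> = hamming_weight ((B_mat k)\<^sup>T *\<^sub>v x)"
    unfolding hamming_weight_B_encoding[OF x] using bits by (intro sum.cong) auto
  finally have w_eq: "w = hamming_weight ((B_mat k)\<^sup>T *\<^sub>v x)" .
  have "hamming_weight ((B_mat k)\<^sup>T *\<^sub>v 0\<^sub>v k) = 0"
    by (simp add: hamming_weight_B_encoding suffix_sum_def)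
  then have "x \<noteq> 0\<^sub>v k"
    using w w_eq by auto
  with x w_eq show "w \<in> (\<lambda>x. hamming_weight ((B_mat k)\<^sup>T *\<^sub>v x)) ` (carrier_vec k - {0\<^sub>v k})"
    by blast
qed

lemma card_bit: "CARD(bit) = 2"
proof -
  have "(UNIV :: bit set) = {0, 1}"
    using bit_not_zero_iff by blast
  then have "CARD(bit) = card {0, 1 :: bit}"
    by (rule arg_cong)
  then show ?thesis
    by simp
qed

section \<open>The two-dimensional codes \<open>D\<^sub>q\<close>\<close>

lemma card_field_ge_2: "2 \<le> CARD('a::{field,finite})"
proof -
  have "card {0::'a, 1} \<le> CARD('a)"
    by (rule card_mono) auto
  then show ?thesis
    by simp
qed

lemma hamming_weight_mat_of_cols:
  assumes "set cs \<subseteq> carrier_vec k"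
  shows "hamming_weight ((mat_of_cols k cs)\<^sup>T *\<^sub>v x) = length (filter (\<lambda>c. c \<bullet> x \<noteq> 0) cs)"
proof -
  have "col (mat_of_cols k cs) j = cs ! j" if "j < length cs" for j
    using assms that by (intro col_mat_of_cols) auto
  then show ?thesis
    unfolding hamming_weight_def length_filter_conv_card
    by (intro arg_cong[where f = card]) auto
qed

lemma primitive_element_nonzero: "primitive_element (\<alpha>::'a::field) \<Longrightarrow> \<alpha> \<noteq> 0"
  unfolding primitive_element_def using power_one_right[of \<alpha>] by blast

text \<open>
  A column \<open>(1, t)\<close> with \<open>t \<noteq> 0\<close> is repeated as often as the exponent of \<open>\<alpha>\<close> in \<open>t\<close> says, so a
  nonzero field element needs a unique exponent between \<open>1\<close> and \<open>q - 1\<close>. The element \<open>1\<close> gets the exponent \<open>q - 1\<close>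
  rather than \<open>0\<close>, and so occurs among the columns.
\<close>

lemma bij_betw_powers_primitive_element:
  fixes \<alpha> :: "'a::{field,finite}"
  assumes "primitive_element \<alpha>"
  shows "bij_betw (\<lambda>i. \<alpha> ^ i) {1..<CARD('a)} (UNIV - {0})"
proof -
  let ?N = "UNIV - {0} :: 'a set" and ?q = "CARD('a)"
  have N: "?N = {\<alpha> ^ i | i :: nat. True}" and nz: "\<alpha> \<noteq> 0"
    using assms primitive_element_nonzero by (auto simp: primitive_element_def)
  have card_N: "card ?N = ?q - 1"
    by (simp add: card_Diff_singleton)
  have q: "2 \<le> ?q"
    by (rule card_field_ge_2)
  \<comment> \<open>Multiplication by \<open>\<alpha>\<close> permutes the nonzero elements, hence preserves their product.\<close>
  have "(\<Prod>x\<in>?N. x) = (\<Prod>x\<in>?N. \<alpha> * x)"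
    by (rule prod.reindex_bij_witness[where i = "\<lambda>x. \<alpha> * x" and j = "\<lambda>x. x / \<alpha>"]) (use nz in auto)
  also have "\<dots> = \<alpha> ^ (?q - 1) * (\<Prod>x\<in>?N. x)"
    by (simp add: prod.distrib card_N)
  finally have one: "\<alpha> ^ (?q - 1) = 1"
    by simp
  have "?N \<subseteq> (\<lambda>i. \<alpha> ^ i) ` {1..<?q}"
  proof
    fix x assume "x \<in> ?N"
    then obtain i where x: "x = \<alpha> ^ i"
      unfolding N by auto
    define r where "r = i mod (?q - 1)"
    have "\<alpha> ^ i = \<alpha> ^ ((?q - 1) * (i div (?q - 1)) + r)"
      by (simp add: r_def)
    also have "\<dots> = \<alpha> ^ r"
      by (simp only: power_add power_mult one power_one mult_1)
    finally have xr: "x = \<alpha> ^ r"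
      by (simp add: x)
    have "r < ?q - 1"
      using q by (simp add: r_def)
    then have "(if r = 0 then ?q - 1 else r) \<in> {1..<?q}"
      using q by auto
    moreover have "x = \<alpha> ^ (if r = 0 then ?q - 1 else r)"
      using one by (simp add: xr)
    ultimately show "x \<in> (\<lambda>i. \<alpha> ^ i) ` {1..<?q}"
      by (rule rev_image_eqI)
  qed
  then have im: "(\<lambda>i. \<alpha> ^ i) ` {1..<?q} = ?N"
    using nz by auto
  then have "inj_on (\<lambda>i. \<alpha> ^ i) {1..<?q}"
    by (intro eq_card_imp_inj_on) (simp_all add: card_N)
  with im show ?thesis
    by (simp add: bij_betw_def)
qed

lemma vec_of_list_pair_carrier: "vec_of_list [a, b] \<in> carrier_vec 2"
  by (intro carrier_vecI) simp

lemma D_columns_carrier: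
  "set (concat (map (\<lambda>i. replicate i (vec_of_list [1, \<alpha> ^ i])) [1..<q])
      @ replicate q (vec_of_list [1, 0])) \<subseteq> carrier_vec 2"
  using vec_of_list_pair_carrier by (fastforce simp del: vec_of_list_Cons upt_Suc)

lemma sum_list_upt_if:
  "(\<Sum>i\<leftarrow>[1..<q]. if P i then i else (0::nat)) = (\<Sum>i\<in>{i. 1 \<le> i \<and> i < q \<and> P i}. i)"
  by (simp add: sum_list_distinct_conv_sum_set sum.If_cases Int_def)

lemma length_filter_concat_replicate:
  "length (filter P (concat (map (\<lambda>i. replicate i (f i)) is)))
    = (\<Sum>i\<leftarrow>is. if P (f i) then i else 0)"
  by (induction "is") auto

lemma D_scalar_prod:
  assumes "x \<in> carrier_vec 2"
  shows "vec_of_list [a, b] \<bullet> x = a * x $ 0 + b * x $ 1"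
  using assms by (simp add: scalar_prod_def numeral_2_eq_2 vec_of_list_index)

text \<open>
  Weight plus number of zeros is the length. The zeros are counted column by column: a root
  \<open>\<alpha> ^ i\<close> of the encoded polynomial contributes \<open>i\<close> zeros, a root \<open>0\<close> contributes \<open>q\<close>.
\<close>

lemma hamming_weight_D_encoding:
  fixes \<alpha> :: "'a::{field,finite}"
  assumes x: "x \<in> carrier_vec 2"
  shows "hamming_weight ((D_mat \<alpha>)\<^sup>T *\<^sub>v x) +
     ((\<Sum>i | 1 \<le> i \<and> i < CARD('a) \<and> x $ 0 + \<alpha> ^ i * x $ 1 = 0. i) + (if x $ 0 = 0 then CARD('a) else 0))
     = CARD('a) * (CARD('a) + 1) div 2"
proof -
  define cs where "cs = concat (map (\<lambda>i. replicate i (vec_of_list [1, \<alpha> ^ i])) [1..<CARD('a)])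
      @ replicate CARD('a) (vec_of_list [1, 0])"
  have D: "D_mat \<alpha> = mat_of_cols 2 cs"
    by (simp add: D_mat_def cs_def)
  have len: "length cs = CARD('a) * (CARD('a) + 1) div 2"
    using D_mat_carrier[of \<alpha>] unfolding D by auto
  have "hamming_weight ((D_mat \<alpha>)\<^sup>T *\<^sub>v x) = length (filter (\<lambda>c. c \<bullet> x \<noteq> 0) cs)"
    unfolding D by (intro hamming_weight_mat_of_cols) (simp only: cs_def D_columns_carrier)
  moreover have "length (filter (\<lambda>c. c \<bullet> x = 0) cs) =
      (\<Sum>i | 1 \<le> i \<and> i < CARD('a) \<and> x $ 0 + \<alpha> ^ i * x $ 1 = 0. i)
        + (if x $ 0 = 0 then CARD('a) else 0)"
    unfolding cs_def filter_append length_append length_filter_concat_replicate sum_list_upt_if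
      filter_replicate D_scalar_prod[OF x]
    by simp
  ultimately show ?thesis
    using sum_length_filter_compl[of "\<lambda>c. c \<bullet> x = 0" cs] len by simp
qed


text \<open>
  The three kinds of nonzero messages \<open>(a, b)\<close> are those without a root (\<open>b = 0\<close>), those with root
  \<open>0\<close> (\<open>a = 0\<close>), and those with a nonzero root \<open>- a / b = \<alpha> ^ i\<close>; their codewords have \<open>0\<close>, \<open>q\<close> and \<open>i\<close> zeros.
  The messages \<open>(1, 0)\<close>, \<open>(0, 1)\<close> and \<open>(- \<alpha> ^ i, 1)\<close> realise all these numbers.
\<close>

lemma D_spectrum:
  fixes \<alpha> :: "'a::{field,finite}"
  assumes prim: "primitive_element \<alpha>" and n: "n = CARD('a) * (CARD('a) + 1) div 2"
  shows "(\<lambda>x. hamming_weight ((D_mat \<alpha>)\<^sup>T *\<^sub>v x)) ` (carrier_vec 2 - {0\<^sub>v 2})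
      = {n - CARD('a)..n}"
proof -
  let ?q = "CARD('a)" and ?W = "\<lambda>x. hamming_weight ((D_mat \<alpha>)\<^sup>T *\<^sub>v x)"
  let ?Z = "\<lambda>x. {i. 1 \<le> i \<and> i < ?q \<and> x $ 0 + \<alpha> ^ i * x $ 1 = 0}"
  have bij: "bij_betw (\<lambda>i. \<alpha> ^ i) {1..<?q} (UNIV - {0})"
    by (rule bij_betw_powers_primitive_element[OF prim])
  note W = hamming_weight_D_encoding[of _ \<alpha>, folded n]
  have const: "?W x = n" if x: "x \<in> carrier_vec 2" "x $ 1 = 0" "x $ 0 \<noteq> 0" for x
    using W[OF x(1)] x(2,3) by simp
  have zero_root: "?W x + ?q = n" if x: "x \<in> carrier_vec 2" "x $ 1 \<noteq> 0" "x $ 0 = 0" for x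
    using W[OF x(1)] x(2,3) primitive_element_nonzero[OF prim] by simp
  have power_root: "?W x + i = n"
    if x: "x \<in> carrier_vec 2" "x $ 1 \<noteq> 0" and i: "i \<in> {1..<?q}"
      and root: "x $ 0 + \<alpha> ^ i * x $ 1 = 0" for x i
  proof -
    have "j = i" if j: "j \<in> ?Z x" for j
    proof -
      have "x $ 0 + \<alpha> ^ j * x $ 1 = x $ 0 + \<alpha> ^ i * x $ 1"
        using j root by simp
      then have "\<alpha> ^ j = \<alpha> ^ i"
        using x(2) by simp
      then show ?thesis
        using bij_betw_imp_inj_on[OF bij] i j by (auto dest: inj_onD)
    qed
    then have "?Z x = {i}"
      using i root by auto
    moreover have "x $ 0 \<noteq> 0"
      using root x(2) primitive_element_nonzero[OF prim] by auto
    ultimately show ?thesis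
      using W[OF x(1)] by simp
  qed
  show ?thesis
  proof (intro equalityI subsetI)
    fix w assume "w \<in> ?W ` (carrier_vec 2 - {0\<^sub>v 2})"
    then obtain x where x: "x \<in> carrier_vec 2" "x \<noteq> 0\<^sub>v 2" and w: "w = ?W x"
      by auto
    have "\<exists>i\<le>?q. w + i = n"
    proof (cases "x $ 1 = 0")
      case True
      have "x $ 0 \<noteq> 0"
      proof
        assume "x $ 0 = 0"
        then have "x = 0\<^sub>v 2"
          using x(1) True by (intro eq_vecI) (auto simp: less_2_cases_iff)
        with x(2) show False ..
      qed
      then show ?thesis
        using const[OF x(1) True] w by auto
    next
      case x1: False
      show ?thesis
      proof (cases "x $ 0 = 0")
        case True
        then show ?thesis
          using zero_root[OF x(1) x1] w by auto
      next
        case False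
        then have "- x $ 0 / x $ 1 \<in> (\<lambda>i. \<alpha> ^ i) ` {1..<?q}"
          using x1 unfolding bij_betw_imp_surj_on[OF bij] by simp
        then obtain i where i: "i \<in> {1..<?q}" and "\<alpha> ^ i = - x $ 0 / x $ 1"
          by (metis imageE)
        then have "x $ 0 + \<alpha> ^ i * x $ 1 = 0"
          using x1 by simp
        from power_root[OF x(1) x1 i this] show ?thesis
          using i w by (intro exI[of _ i]) simp
      qed
    qed
    then show "w \<in> {n - ?q..n}"
      by auto
  next
    fix w assume w: "w \<in> {n - ?q..n}"
    define i where "i = n - w"
    have "?q \<le> n"
      using W[of "unit_vec 2 1"] by simp
    then have i: "i \<le> ?q" "w + i = n"
      using w by (auto simp: i_def)
    have *: "w \<in> ?W ` (carrier_vec 2 - {0\<^sub>v 2})"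
      if "?W (vec_of_list [a, b]) + i = n" "a \<noteq> 0 \<or> b \<noteq> 0" for a b
    proof (rule image_eqI)
      show "w = ?W (vec_of_list [a, b])"
        using that i(2) by simp
      have "vec_of_list [a, b] \<noteq> 0\<^sub>v 2"
      proof
        assume eq: "vec_of_list [a, b] = 0\<^sub>v 2"
        have "vec_of_list [a, b] $ 0 = 0" "vec_of_list [a, b] $ 1 = 0"
          unfolding eq by simp_all
        with that(2) show False
          by simp
      qed
      then show "vec_of_list [a, b] \<in> carrier_vec 2 - {0\<^sub>v 2}"
        using vec_of_list_pair_carrier[of a b] by (simp del: vec_of_list_Cons)
    qed
    consider "i = 0" | "i = ?q" | "i \<in> {1..<?q}"
      using i(1) by fastforce
    then show "w \<in> ?W ` (carrier_vec 2 - {0\<^sub>v 2})"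
    proof cases
      case 1
      then show ?thesis
        using const[of "vec_of_list [1, 0]"]
        by (intro *[of 1 0])
           (simp_all add: vec_of_list_pair_carrier vec_of_list_index del: vec_of_list_Cons)
    next
      case 2
      then show ?thesis
        using zero_root[of "vec_of_list [0, 1]"]
        by (intro *[of 0 1])
           (simp_all add: vec_of_list_pair_carrier vec_of_list_index del: vec_of_list_Cons)
    next
      case 3
      then show ?thesis
        using power_root[of "vec_of_list [- (\<alpha> ^ i), 1]" i]
        by (intro *[of "- (\<alpha> ^ i)" 1])
           (simp_all add: vec_of_list_pair_carrier vec_of_list_index del: vec_of_list_Cons)
    qed
  qed
qed

lemma num_points_2:
  assumes "2 \<le> q"
  shows "num_points q 2 = q + 1"
proof -
  obtain r where q: "q = r + 2"
    using assms by (metis add.commute le_Suc_ex)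
  have "q ^ 2 - 1 = (q - 1) * (q + 1)"
    by (simp add: q power2_eq_square algebra_simps)
  moreover have "q - 1 \<noteq> 0"
    using assms by simp
  ultimately show ?thesis
    unfolding num_points_def by (metis nonzero_mult_div_cancel_left)
qed

lemma D_length_minus_card:
  fixes q :: nat
  assumes "2 \<le> q"
  shows "q * (q + 1) div 2 - q = q * (q - 1) div 2" "q \<le> q * (q + 1) div 2"
    "1 \<le> q * (q - 1) div 2"
proof -
  obtain r where q: "q = r + 2"
    using assms by (metis add.commute le_Suc_ex)
  have "q * (q + 1) = q * (q - 1) + q * 2"
    by (simp add: q algebra_simps)
  then have "q * (q + 1) div 2 = q * (q - 1) div 2 + q"
    by simp
  then show "q * (q + 1) div 2 - q = q * (q - 1) div 2" "q \<le> q * (q + 1) div 2"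
    by simp_all
  have "2 * 1 \<le> q * (q - 1)"
    using assms by (intro mult_le_mono) auto
  then show "1 \<le> q * (q - 1) div 2"
    by simp
qed

theorem proposition6:
  shows "(\<forall>k::nat. k \<ge> 1 \<longrightarrow>
            code_dim (2 ^ k - 1) (B_code k) = k \<and>
            strictly_compact_mws_code (2 ^ k - 1) (B_code k) \<and>
            weights (B_code k) = {1..2 ^ k - 1})
       \<and> (\<forall>(q::nat) (\<alpha>::'a::{field,finite}). q = CARD('a) \<and> primitive_element \<alpha> \<longrightarrow>
            code_dim (q * (q + 1) div 2) (D_code \<alpha>) = 2 \<and>
            strictly_compact_mws_code (q * (q + 1) div 2) (D_code \<alpha>) \<and>
            min_dist (D_code \<alpha>) = q * (q - 1) div 2 \<and>
            weights (D_code \<alpha>) = {q * (q - 1) div 2..q * (q + 1) div 2})"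
proof (rule conjI; intro allI impI)
  fix k :: nat assume k: "1 \<le> k"
  have pow: "(2::nat) ^ 1 \<le> 2 ^ k"
    using k by (intro power_increasing) auto
  have B: "B_code k = code_of (B_mat k)"
    by (simp add: B_code_def B_mat_def)
  have "1 \<le> 2 ^ k - (1::nat)" "2 ^ k - 1 + 1 - 1 = num_points CARD(bit) k"
    using pow by (simp_all add: num_points_def card_bit)
  note code = strictly_compact_code_of[OF B_mat_carrier order_refl this B_spectrum]
  show "code_dim (2 ^ k - 1) (B_code k) = k \<and>
      strictly_compact_mws_code (2 ^ k - 1) (B_code k) \<and> weights (B_code k) = {1..2 ^ k - 1}"
    unfolding B using code by blast
next
  fix q :: nat and \<alpha> :: 'a
  assume "q = CARD('a) \<and> primitive_element \<alpha>"
  then have q: "q = CARD('a)" and prim: "primitive_element \<alpha>"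
    by auto
  have q2: "2 \<le> q"
    unfolding q by (rule card_field_ge_2)
  let ?n = "q * (q + 1) div 2" and ?d = "q * (q - 1) div 2"
  note arith = D_length_minus_card[OF q2]
  have G: "D_mat \<alpha> \<in> carrier_mat 2 ?n"
    unfolding q by (rule D_mat_carrier)
  have spectrum: "(\<lambda>x. hamming_weight ((D_mat \<alpha>)\<^sup>T *\<^sub>v x)) ` (carrier_vec 2 - {0\<^sub>v 2}) = {?d..?n}"
    using D_spectrum[OF prim, of ?n] unfolding q[symmetric] arith(1) by simp
  have "?d \<le> ?n"
    unfolding arith(1)[symmetric] by (rule diff_le_self)
  moreover have "?n + 1 - ?d = num_points CARD('a) 2"
    unfolding q[symmetric] num_points_2[OF q2] using arith(1,2) by linarith
  ultimately show "code_dim ?n (D_code \<alpha>) = 2 \<and> strictly_compact_mws_code ?n (D_code \<alpha>) \<and>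
      min_dist (D_code \<alpha>) = ?d \<and> weights (D_code \<alpha>) = {?d..?n}"
    unfolding D_code_def using strictly_compact_code_of[OF G arith(3) _ _ spectrum] by blast
qed

end
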